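(* For all $n\ge1$ and $1\le k\le n$, the number of U-words $u$ of length $n$ with $u_n=n+1-k$ equals $E_{n,k}$.
   Context: $E_{n,k}$ is the number of permutations $\pi$ of $\{1,\dots,n\}$ with $\pi_1>\pi_2<\pi_3>\cdots$ and $\pi_1=k$. A U-word of length $n$ is a sequence $u=(u_1,\dots,u_n)$ of positive integers with $u_1=1$ and $u_i+u_{i-1}\le i$ for $2\le i\le n$. *)

theory Defs
  imports "HOL-Combinatorics.Permutations"
begin

definition down_up :: "nat \<Rightarrow> (nat \<Rightarrow> nat) \<Rightarrow> bool" where
  "down_up n p \<longleftrightarrow>
     (\<forall>i. 1 \<le> i \<and> i < n \<longrightarrow> (if odd i then p i > p (i + 1) else p i < p (i + 1)))"

definition entringer :: "nat \<Rightarrow> nat \<Rightarrow> nat" where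
  "entringer n k = card {p. p permutes {1..n} \<and> down_up n p \<and> p 1 = k}"

(* The entry u_i, for i from 1 to n, is the list element u ! (i - 1). *)
definition U_word :: "nat \<Rightarrow> nat list \<Rightarrow> bool" where
  "U_word n u \<longleftrightarrow>
     length u = n \<and> (\<forall>x\<in>set u. x > 0) \<and> u ! 0 = 1 \<and>
     (\<forall>i. 2 \<le> i \<and> i \<le> n \<longrightarrow> u ! (i - 1) + u ! (i - 2) \<le> i)"

end

theory Submission
  imports Defs
begin

text \<open>Both counts satisfy the recurrence \<open>a (n + 1) k = (\<Sum>j\<in>{1..<k}. a n (n + 1 - j))\<close>.
  For words, delete the last entry; here \<open>j\<close> is the entry before it. For permutations, delete the
  first entry \<open>k\<close>, standardize, and complement: the second entry \<open>j < k\<close> becomes the first entry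
  \<open>n + 1 - j\<close>, and complementing restores the down-up pattern.\<close>

section \<open>Words\<close>

text \<open>Each inequality links two neighbouring entries, so appending \<open>m\<close> adds only
  the one at index \<open>Suc n\<close>. With \<open>n \<ge> 1\<close> the first entry is still that
  of \<open>v\<close>.\<close>

lemma U_word_snoc:
  assumes "n \<ge> 1"
  shows "U_word (Suc n) (v @ [m]) \<longleftrightarrow> U_word n v \<and> m > 0 \<and> v ! (n - 1) + m \<le> Suc n"
proof (cases "length v = n")
  case True
  have old: "(v @ [m]) ! (i - 1) = v ! (i - 1)" "(v @ [m]) ! (i - 2) = v ! (i - 2)"
    if "2 \<le> i \<and> i \<le> n" for i
    using that True by (auto simp: nth_append)
  have new: "(v @ [m]) ! (Suc n - 1) = m" "(v @ [m]) ! (Suc n - 2) = v ! (n - 1)"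
    using assms True by (auto simp: nth_append)
  have "2 \<le> i \<and> i \<le> Suc n \<longleftrightarrow> 2 \<le> i \<and> i \<le> n \<or> i = Suc n" for i
    using assms by auto
  then have "(\<forall>i. 2 \<le> i \<and> i \<le> Suc n \<longrightarrow> (v @ [m]) ! (i - 1) + (v @ [m]) ! (i - 2) \<le> i) \<longleftrightarrow>
    (\<forall>i. 2 \<le> i \<and> i \<le> n \<longrightarrow> (v @ [m]) ! (i - 1) + (v @ [m]) ! (i - 2) \<le> i) \<and>
    (v @ [m]) ! (Suc n - 1) + (v @ [m]) ! (Suc n - 2) \<le> Suc n"
    by metis
  also have "\<dots> \<longleftrightarrow> (\<forall>i. 2 \<le> i \<and> i \<le> n \<longrightarrow> v ! (i - 1) + v ! (i - 2) \<le> i) \<and>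
      v ! (n - 1) + m \<le> Suc n"
    using old new by (simp add: add.commute)
  finally show ?thesis
    using True assms unfolding U_word_def by (simp add: nth_append) blast
\<comment> \<open>If \<open>v\<close> has the wrong length, both sides are false.\<close>
qed (simp add: U_word_def)

lemma U_word_Suc_iff:
  assumes "n \<ge> 1"
  shows "U_word (Suc n) u \<longleftrightarrow>
    (\<exists>v m. u = v @ [m] \<and> U_word n v \<and> m > 0 \<and> v ! (n - 1) + m \<le> Suc n)"
  by (cases u rule: rev_cases) (simp_all add: U_word_snoc[OF assms], simp add: U_word_def)

lemma U_word_1: "{u. U_word 1 u} = {[1]}"
  by (auto simp: U_word_def length_Suc_conv)

text \<open>The last entry never exceeds the length, so the longer words lie in the image of a
  finite product. Grouping a count by the last entry relies on this.\<close>

lemma finite_U_word: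
  assumes "n \<ge> 1"
  shows "finite {u. U_word n u}"
  using assms
proof (induction n rule: dec_induct)
  case base
  show ?case by (simp only: U_word_1) simp
next
  case (step n)
  have "{u. U_word (Suc n) u} \<subseteq> (\<lambda>(v, m). v @ [m]) ` ({v. U_word n v} \<times> {..Suc n})"
    using step.hyps by (auto simp: U_word_Suc_iff)
  then show ?case
    by (rule finite_subset) (use step.IH in simp)
qed

lemma card_U_word_Suc:
  assumes "n \<ge> 1" "k \<le> Suc n"
  shows "card {u. U_word (Suc n) u \<and> u ! n = Suc n + 1 - k} =
    (\<Sum>j\<in>{1..<k}. card {v. U_word n v \<and> v ! (n - 1) = j})"
proof -
  define m where "m = Suc n + 1 - k"
  let ?A = "{v. U_word n v \<and> v ! (n - 1) < k}"
  \<comment> \<open>Since \<open>k \<le> Suc n\<close>, the subtraction in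
    \<open>m = n + 2 - k\<close> is exact, and the bound on the last two entries turns into
    \<open>j < k\<close>.\<close>
  have m: "m > 0" "\<And>j. j + m \<le> Suc n \<longleftrightarrow> j < k"
    using assms by (auto simp: m_def)
  have len: "length v = n" if "U_word n v" for v
    using that by (simp add: U_word_def)
  have "{u. U_word (Suc n) u \<and> u ! n = m} = (\<lambda>v. v @ [m]) ` ?A"
  proof (intro set_eqI)
    fix u
    have "u \<in> {u. U_word (Suc n) u \<and> u ! n = m} \<longleftrightarrow>
      (\<exists>v m'. u = v @ [m'] \<and> U_word n v \<and> m' > 0 \<and> v ! (n - 1) + m' \<le> Suc n \<and> u ! n = m)"
      unfolding U_word_Suc_iff[OF assms(1)] by blast
    \<comment> \<open>As \<open>v\<close> has length \<open>n\<close>, the entry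
      \<open>u ! n\<close> is the appended one, which forces \<open>m' = m\<close>.\<close>
    also have "\<dots> \<longleftrightarrow> (\<exists>v. u = v @ [m] \<and> U_word n v \<and> m > 0 \<and> v ! (n - 1) + m \<le> Suc n)"
      by (metis len nth_append_length)
    also have "\<dots> \<longleftrightarrow> u \<in> (\<lambda>v. v @ [m]) ` ?A"
      unfolding m(2) using m(1) by blast
    finally show "u \<in> {u. U_word (Suc n) u \<and> u ! n = m} \<longleftrightarrow> u \<in> (\<lambda>v. v @ [m]) ` ?A" .
  qed
  then have "card {u. U_word (Suc n) u \<and> u ! n = m} = card ?A"
    by (simp add: card_image inj_on_def)
  \<comment> \<open>Split by the last entry of \<open>v\<close>; positivity of the entries gives the
    lower end of the range.\<close>
  also have "\<dots> = (\<Sum>j\<in>{1..<k}. \<Sum>v\<in>{v \<in> ?A. v ! (n - 1) = j}. 1)"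
  proof (subst sum.group)
    show "finite ?A" using finite_U_word[OF assms(1)] by simp
    have "0 < v ! (n - 1)" if "U_word n v" for v
      using that assms(1) by (auto simp: U_word_def)
    then show "(\<lambda>v. v ! (n - 1)) ` ?A \<subseteq> {1..<k}"
      by (auto simp: Suc_le_eq)
  qed auto
  also have "\<dots> = (\<Sum>j\<in>{1..<k}. card {v. U_word n v \<and> v ! (n - 1) = j})"
    by (intro sum.cong) (auto intro!: arg_cong[where f = card])
  finally show ?thesis by (simp add: m_def)
qed

section \<open>Permutations\<close>

text \<open>The complement \<open>x \<mapsto> n + 1 - x\<close> followed by the increasing bijection from \<open>{1..n}\<close>
  onto \<open>{1..n + 1} - {k}\<close>.\<close>
definition skip_compl :: "nat \<Rightarrow> nat \<Rightarrow> nat \<Rightarrow> nat" where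
  "skip_compl n k x = (if n + 1 < x + k then n + 1 - x else n + 2 - x)"

text \<open>The inverse relabelling: close the gap at \<open>k\<close>, then complement.\<close>

definition unskip_compl :: "nat \<Rightarrow> nat \<Rightarrow> nat \<Rightarrow> nat" where
  "unskip_compl n k y = (if y < k then n + 1 - y else n + 2 - y)"

text \<open>The entries of \<open>q\<close> move one place to the right to make room for
  \<open>k\<close>; outside \<open>{1..Suc n}\<close> the identity is what \<open>permutes\<close>
  demands.\<close>

definition extend_perm :: "nat \<Rightarrow> nat \<Rightarrow> (nat \<Rightarrow> nat) \<Rightarrow> nat \<Rightarrow> nat" where
  "extend_perm n k q i =
     (if i = 1 then k else if i \<in> {2..Suc n} then skip_compl n k (q (i - 1)) else i)"

definition reduce_perm :: "nat \<Rightarrow> nat \<Rightarrow> (nat \<Rightarrow> nat) \<Rightarrow> nat \<Rightarrow> nat" where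
  "reduce_perm n k p i = (if i \<in> {1..n} then unskip_compl n k (p (Suc i)) else i)"

section \<open>Relabelling the values other than k\<close>

context
  fixes n k :: nat
  assumes k: "1 \<le> k" "k \<le> Suc n"
begin

lemma unskip_skip:
  "x \<in> {1..n} \<Longrightarrow> unskip_compl n k (skip_compl n k x) = x"
  using k by (auto simp: skip_compl_def unskip_compl_def)

lemma skip_unskip:
  "y \<in> {1..Suc n} - {k} \<Longrightarrow> skip_compl n k (unskip_compl n k y) = y"
  using k by (auto simp: skip_compl_def unskip_compl_def)

lemma skip_compl_in:
  "x \<in> {1..n} \<Longrightarrow> skip_compl n k x \<in> {1..Suc n} - {k}"
  using k by (auto simp: skip_compl_def)

lemma unskip_compl_in:
  "y \<in> {1..Suc n} - {k} \<Longrightarrow> unskip_compl n k y \<in> {1..n}"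
  using k by (auto simp: unskip_compl_def)

text \<open>Complementing reverses the order and skipping \<open>k\<close> preserves it.\<close>

lemma skip_compl_less_iff:
  "x \<in> {1..n} \<Longrightarrow> y \<in> {1..n} \<Longrightarrow> skip_compl n k x < skip_compl n k y \<longleftrightarrow> y < x"
  using k by (auto simp: skip_compl_def)

lemma skip_compl_less_k_iff:
  "x \<in> {1..n} \<Longrightarrow> skip_compl n k x < k \<longleftrightarrow> n + 1 < x + k"
  using k by (auto simp: skip_compl_def)

text \<open>An injective self-map of a finite set is onto, so surjectivity need not be checked
  separately.\<close>

lemma permutes_finiteI:
  assumes "finite S" "inj_on f S" "f ` S \<subseteq> S" "\<And>x. x \<notin> S \<Longrightarrow> f x = x"
  shows "f permutes S"
  using assms by (intro bij_imp_permutes) (auto simp: bij_betw_def endo_inj_surj)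

section \<open>Prepending and deleting the first entry k\<close>

lemma extend_perm_permutes:
  assumes q: "q permutes {1..n}"
  shows "extend_perm n k q permutes {1..Suc n}"
proof (rule permutes_finiteI)
  have q_in: "q (i - 1) \<in> {1..n}" if "i \<in> {2..Suc n}" for i
    using permutes_in_image[OF q, of "i - 1"] that by auto
  have s: "skip_compl n k (q (i - 1)) \<in> {1..Suc n} - {k}" if "i \<in> {2..Suc n}" for i
    by (intro skip_compl_in q_in that)
  have inj: "i = j" if "i \<in> {2..Suc n}" "j \<in> {2..Suc n}"
    "skip_compl n k (q (i - 1)) = skip_compl n k (q (j - 1))" for i j
  proof -
    have "q (i - 1) = q (j - 1)"
      using that by (metis q_in unskip_skip)
    then have "i - 1 = j - 1"
      by (rule injD[OF permutes_inj[OF q]])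
    then show ?thesis using that by auto
  qed
  have split: "{1..Suc n} = insert 1 {2..Suc n}" by auto
  show "inj_on (extend_perm n k q) {1..Suc n}"
    unfolding split
  proof (rule inj_onI)
    fix i j
    assume ij: "i \<in> insert 1 {2..Suc n}" "j \<in> insert 1 {2..Suc n}"
      and eq: "extend_perm n k q i = extend_perm n k q j"
    show "i = j"
    \<comment> \<open>Position 1 carries \<open>k\<close>, a value that \<open>skip_compl\<close>
      avoids on \<open>{1..n}\<close>; elsewhere injectivity comes from \<open>q\<close>.\<close>
    proof (cases "i = 1 \<or> j = 1")
      case True
      then show ?thesis
        using ij eq s[of i] s[of j] by (auto simp: extend_perm_def)
    next
      case False
      then have "i \<in> {2..Suc n}" "j \<in> {2..Suc n}"
        using ij by auto
      moreover from this have "skip_compl n k (q (i - 1)) = skip_compl n k (q (j - 1))"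
        using eq False by (simp add: extend_perm_def)
      ultimately show ?thesis by (rule inj)
    qed
  qed
  show "extend_perm n k q ` {1..Suc n} \<subseteq> {1..Suc n}"
  proof (rule image_subsetI)
    fix i assume "i \<in> {1..Suc n}"
    then show "extend_perm n k q i \<in> {1..Suc n}"
      using k s[of i] by (auto simp: extend_perm_def)
  qed
qed (auto simp: extend_perm_def)

lemma permutes_Suc_in:
  assumes p: "p permutes {1..Suc n}" "p 1 = k" and i: "i \<in> {1..n}"
  shows "p (Suc i) \<in> {1..Suc n} - {k}"
proof -
  have "p (Suc i) \<in> {1..Suc n}"
    using permutes_in_image[OF p(1), of "Suc i"] i by auto
  moreover have "p (Suc i) \<noteq> k"
    using injD[OF permutes_inj[OF p(1)], of "Suc i" 1] p(2) i by auto
  ultimately show ?thesis by auto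
qed

lemma reduce_perm_permutes:
  assumes p: "p permutes {1..Suc n}" "p 1 = k"
  shows "reduce_perm n k p permutes {1..n}"
proof (rule permutes_finiteI)
  note p_in = permutes_Suc_in[OF p]
  show "inj_on (reduce_perm n k p) {1..n}"
  proof (rule inj_onI)
    fix i j assume ij: "i \<in> {1..n}" "j \<in> {1..n}" "reduce_perm n k p i = reduce_perm n k p j"
    \<comment> \<open>Away from \<open>k\<close>, \<open>unskip_compl\<close> is undone by
      \<open>skip_compl\<close> and hence injective.\<close>
    then have "p (Suc i) = p (Suc j)"
      by (metis reduce_perm_def p_in skip_unskip)
    then show "i = j"
      using injD[OF permutes_inj[OF p(1)]] by blast
  qed
  show "reduce_perm n k p ` {1..n} \<subseteq> {1..n}"
    using unskip_compl_in[OF p_in] unfolding reduce_perm_def by (simp add: image_subset_iff)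
qed (auto simp: reduce_perm_def)

lemma reduce_extend:
  assumes q: "q permutes {1..n}"
  shows "reduce_perm n k (extend_perm n k q) = q"
proof
  fix i
  show "reduce_perm n k (extend_perm n k q) i = q i"
    using unskip_skip[of "q i"] permutes_in_image[OF q, of i] permutes_not_in[OF q, of i]
    by (auto simp: reduce_perm_def extend_perm_def)
qed

lemma extend_reduce:
  assumes p: "p permutes {1..Suc n}" "p 1 = k"
  shows "extend_perm n k (reduce_perm n k p) = p"
proof
  fix i
  consider "i = 1" | "i \<in> {2..Suc n}" | "i \<notin> {1..Suc n}" by fastforce
  then show "extend_perm n k (reduce_perm n k p) i = p i"
  proof cases
    case 1
    then show ?thesis using p(2) by (simp add: extend_perm_def)
  next
    case 2
    then have "i - 1 \<in> {1..n}" "Suc (i - 1) = i" by auto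
    with 2 show ?thesis
      using skip_unskip permutes_Suc_in[OF p, of "i - 1"]
      by (auto simp: extend_perm_def reduce_perm_def)
  next
    case 3
    then show ?thesis
      using permutes_not_in[OF p(1), of i] by (auto simp: extend_perm_def)
  qed
qed

text \<open>The descent at position 1 compares \<open>k\<close> with the relabelled
  \<open>q 1\<close> and yields the inequality. At later positions the shift by one flips the parity
  and the relabelling reverses the order, so the two reversals cancel.\<close>

lemma down_up_extend:
  assumes "n \<ge> 1" and q: "q permutes {1..n}"
  shows "down_up (Suc n) (extend_perm n k q) \<longleftrightarrow> down_up n q \<and> n + 1 < q 1 + k"
proof -
  let ?p = "extend_perm n k q"
  let ?R = "\<lambda>p i. if odd i then p i > p (i + 1) else p i < (p (i + 1) :: nat)"
  have q_in: "q i \<in> {1..n}" if "i \<in> {1..n}" for i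
    using permutes_in_image[OF q, of i] that by auto
  have p_Suc: "?p (Suc i) = skip_compl n k (q i)" if "i \<in> {1..n}" for i
    using that by (auto simp: extend_perm_def)
  have first: "?R ?p 1 \<longleftrightarrow> n + 1 < q 1 + k"
    using assms p_Suc[of 1] skip_compl_less_k_iff[OF q_in[of 1]]
    by (simp add: extend_perm_def)
  have later: "?R ?p (Suc i) \<longleftrightarrow> ?R q i" if "1 \<le> i" "i < n" for i
    using that p_Suc[of i] p_Suc[of "Suc i"] skip_compl_less_iff[OF q_in q_in, of i "Suc i"]
      skip_compl_less_iff[OF q_in q_in, of "Suc i" i] by simp
  have range: "{i. 1 \<le> i \<and> i < Suc n} = insert 1 (Suc ` {i. 1 \<le> i \<and> i < n})"
    using assms(1) by (auto simp: image_iff) presburger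
  have "down_up (Suc n) ?p \<longleftrightarrow> (\<forall>i\<in>{i. 1 \<le> i \<and> i < Suc n}. ?R ?p i)"
    unfolding down_up_def by blast
  also have "\<dots> \<longleftrightarrow> ?R ?p 1 \<and> (\<forall>i\<in>{i. 1 \<le> i \<and> i < n}. ?R ?p (Suc i))"
    unfolding range by blast
  also have "\<dots> \<longleftrightarrow> n + 1 < q 1 + k \<and> (\<forall>i\<in>{i. 1 \<le> i \<and> i < n}. ?R q i)"
    using first later by blast
  finally show ?thesis
    unfolding down_up_def by blast
qed

text \<open>\<open>extend_perm\<close> is a bijection from the permutations with
  \<open>n + 1 < q 1 + k\<close>. Grouping these by \<open>j = n + 1 - q 1\<close> turns the
  inequality into \<open>j < k\<close>, and \<open>q 1 \<le> n\<close> gives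
  \<open>j \<ge> 1\<close>.\<close>

lemma entringer_Suc:
  assumes "n \<ge> 1"
  shows "entringer (Suc n) k = (\<Sum>j\<in>{1..<k}. entringer n (n + 1 - j))"
proof -
  let ?A = "{q. q permutes {1..n} \<and> down_up n q \<and> n + 1 < q 1 + k}"
  let ?B = "{p. p permutes {1..Suc n} \<and> down_up (Suc n) p \<and> p 1 = k}"
  have q1: "q 1 \<in> {1..n}" if "q permutes {1..n}" for q
    using permutes_in_image[OF that, of 1] assms by auto
  have "bij_betw (extend_perm n k) ?A ?B"
  proof (rule bij_betw_byWitness[where f' = "reduce_perm n k"])
    show "extend_perm n k ` ?A \<subseteq> ?B"
      using down_up_extend[OF assms] extend_perm_permutes by (auto simp: extend_perm_def)
    show "reduce_perm n k ` ?B \<subseteq> ?A"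
    proof (rule image_subsetI)
      fix p assume p: "p \<in> ?B"
      then have r: "reduce_perm n k p permutes {1..n}"
        by (intro reduce_perm_permutes) auto
      then show "reduce_perm n k p \<in> ?A"
        using down_up_extend[OF assms r] extend_reduce[of p] p by auto
    qed
  qed (auto simp: reduce_extend extend_reduce)
  then have "entringer (Suc n) k = card ?A"
    unfolding entringer_def by (simp only: bij_betw_same_card)
  also have "\<dots> = (\<Sum>j\<in>{1..<k}. \<Sum>q\<in>{q \<in> ?A. n + 1 - q 1 = j}. 1)"
  proof (subst sum.group)
    show "finite ?A"
      by (rule finite_subset[OF _ finite_permutations[of "{1..n}"]]) auto
    show "(\<lambda>q. n + 1 - q 1) ` ?A \<subseteq> {1..<k}"
    proof (rule image_subsetI)
      fix q assume "q \<in> ?A"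
      then show "n + 1 - q 1 \<in> {1..<k}" using q1[of q] by auto
    qed
  qed auto
  also have "\<dots> = (\<Sum>j\<in>{1..<k}. entringer n (n + 1 - j))"
  proof (rule sum.cong)
    fix j assume j: "j \<in> {1..<k}"
    \<comment> \<open>Here \<open>q 1\<close> and \<open>j\<close> both lie in
      \<open>{1..n}\<close>, so no subtraction is truncated, and \<open>j < k\<close> supplies the
      inequality.\<close>
    have "n + 1 < q 1 + k \<and> n + 1 - q 1 = j \<longleftrightarrow> q 1 = n + 1 - j" if "q permutes {1..n}" for q
      using q1[OF that] j k by auto
    then have "{q \<in> ?A. n + 1 - q 1 = j} =
        {q. q permutes {1..n} \<and> down_up n q \<and> q 1 = n + 1 - j}"
      by blast
    then show "(\<Sum>q\<in>{q \<in> ?A. n + 1 - q 1 = j}. 1) = entringer n (n + 1 - j)"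
      by (simp add: entringer_def)
  qed simp
  finally show ?thesis .
qed

end

section \<open>Induction on the length\<close>

lemma entringer_1: "entringer 1 1 = 1"
proof -
  have "{p. p permutes {1..1::nat} \<and> down_up 1 p \<and> p 1 = 1} = {id}"
    by (auto simp only: down_up_def permutes_sing atLeastAtMost_singleton id_apply)
  then show ?thesis by (simp add: entringer_def)
qed

theorem theorem11:
  fixes n k :: nat
  assumes "n \<ge> 1" and "1 \<le> k" and "k \<le> n"
  shows "card {u. U_word n u \<and> u ! (n - 1) = n + 1 - k} = entringer n k"
  using assms
proof (induction n arbitrary: k rule: dec_induct)
  case base
  then have "k = 1" by simp
  moreover have "{u. U_word 1 u \<and> u ! 0 = 1} = {[1]}"
    by (auto simp: U_word_def length_Suc_conv)
  ultimately show ?case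
    using entringer_1 by simp
next
  case (step n)
  \<comment> \<open>The induction hypothesis is used at \<open>n + 1 - j\<close>, which lies in
    \<open>{1..n}\<close> because \<open>1 \<le> j < k \<le> n + 1\<close>; its last entry
    \<open>n + 1 - (n + 1 - j)\<close> is \<open>j\<close>. The two recurrences then agree term by
    term.\<close>
  have "card {v. U_word n v \<and> v ! (n - 1) = j} = entringer n (n + 1 - j)" if "j \<in> {1..<k}" for j
    using step.IH[of "n + 1 - j"] step.prems that by auto
  then show ?case
    using card_U_word_Suc[of n k] entringer_Suc[of k n] step.hyps step.prems by simp
qed

end
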